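(* Let $f:\mathbb{R}^{n_x}\times\mathbb{R}^{n_y}\to\mathbb{R}$ be continuously differentiable, such that for all $x\in\mathbb{R}^{n_x}$ the function $f(x,\cdot)$ is incave and decreasing at infinity, and for all $y\in\mathbb{R}^{n_y}$ the function $f(\cdot,y)$ is invex and increasing at infinity. Assume that for all $(x,y)\in\underline{M}$ the best response map $\mathrm{BR}_y(\cdot)$ is locally inner Lipschitz continuous at $x$ for $y$, and conversely that for all $(x,y)\in\overline{M}$ the best response map $\mathrm{BR}_x(\cdot)$ is locally inner Lipschitz continuous at $y$ for $x$. Then $E=\underline{M}=\overline{M}$ and this common set is connected.
   Context: A differentiable function $g:\mathbb{R}^n\to\mathbb{R}$ is invex if every stationary point of $g$ is a global minimum of $g$; $g$ is incave if $-g$ is invex. $g$ is increasing at infinity if for every $x$ there is a compact set $K$ with $g(z)>g(x)$ for all $z\notin K$; $g$ is decreasing at infinity if $-g$ is increasing at infinity. Best response maps: $\mathrm{BR}_x(y)=\arg\min_{x\in\mathbb{R}^{n_x}}f(x,y)$ and $\mathrm{BR}_y(x)=\arg\max_{y\in\mathbb{R}^{n_y}}f(x,y)$ (set-valued). A point $(x^*,y^* )\in\mathbb{R}^{n_x}\times\mathbb{R}^{n_y}$ is: - a minimax point if for all $(x,y)$: $f(x^*,y)\le f(x^*,y^* )\le\max_{y'}f(x,y')$; the set of minimax points is $\underline{M}$; - a maximin point if for all $(x,y)$: $\min_{x'}f(x',y)\le f(x^*,y^* )\le f(x,y^* )$; the set of maximin points is $\overline{M}$; - a saddle point if for all $(x,y)$: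 $f(x^*,y)\le f(x^*,y^* )\le f(x,y^* )$; the set of saddle points is $E=\underline{M}\cap\overline{M}$. A set-valued map $S:\mathbb{R}^n\rightrightarrows\mathbb{R}^m$ is locally inner Lipschitz continuous at $\bar x$ for $\bar y$ if $\bar y\in S(\bar x)$ and there exist a constant $\kappa\ge0$ and an open neighborhood $N_{\bar x}$ of $\bar x$ such that $d(\bar y,S(x))\le\kappa\|x-\bar x\|$ for all $x\in N_{\bar x}$, where $d(\bar y, A)$ is the Euclidean distance from a point to a set. The empty set is regarded as connected. *)

theory Defs
  imports "HOL-Analysis.Analysis"
begin

definition continuously_differentiable :: "('a::real_inner \<Rightarrow> real) \<Rightarrow> bool" where
  "continuously_differentiable g \<longleftrightarrow>
     (\<exists>G. (\<forall>x. GDERIV g x :> G x) \<and> continuous_on UNIV G)"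

definition invex :: "('a::real_inner \<Rightarrow> real) \<Rightarrow> bool" where
  "invex g \<longleftrightarrow> (\<forall>x. g differentiable (at x)) \<and>
     (\<forall>x. (GDERIV g x :> 0) \<longrightarrow> (\<forall>z. g x \<le> g z))"

definition incave :: "('a::real_inner \<Rightarrow> real) \<Rightarrow> bool" where
  "incave g \<longleftrightarrow> invex (\<lambda>x. - g x)"

definition increasing_at_infinity :: "('a::topological_space \<Rightarrow> real) \<Rightarrow> bool" where
  "increasing_at_infinity g \<longleftrightarrow> (\<forall>x. \<exists>K. compact K \<and> (\<forall>z. z \<notin> K \<longrightarrow> g z > g x))"

definition decreasing_at_infinity :: "('a::topological_space \<Rightarrow> real) \<Rightarrow> bool" where
  "decreasing_at_infinity g \<longleftrightarrow> increasing_at_infinity (\<lambda>x. - g x)"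

definition BR_x :: "('a \<times> 'b \<Rightarrow> real) \<Rightarrow> 'b \<Rightarrow> 'a set" where
  "BR_x f y = {x. is_arg_min (\<lambda>x'. f (x', y)) (\<lambda>_. True) x}"

definition BR_y :: "('a \<times> 'b \<Rightarrow> real) \<Rightarrow> 'a \<Rightarrow> 'b set" where
  "BR_y f x = {y. is_arg_max (\<lambda>y'. f (x, y')) (\<lambda>_. True) y}"

text \<open>The inner maximum and minimum are written as extended-real suprema and infima, so that the
  definitions are meaningful for every \<open>f\<close>. They coincide with the maximum and minimum whenever
  these are attained, e.g. for \<open>f\<close> continuous with \<open>f (x, _)\<close> decreasing and \<open>f (_, y)\<close> increasing
  at infinity.\<close>

definition minimax_points :: "('a \<times> 'b \<Rightarrow> real) \<Rightarrow> ('a \<times> 'b) set" where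
  "minimax_points f = {(xs, ys). \<forall>x y.
     f (xs, y) \<le> f (xs, ys) \<and> ereal (f (xs, ys)) \<le> (SUP y'. ereal (f (x, y')))}"

definition maximin_points :: "('a \<times> 'b \<Rightarrow> real) \<Rightarrow> ('a \<times> 'b) set" where
  "maximin_points f = {(xs, ys). \<forall>x y.
     (INF x'. ereal (f (x', y))) \<le> ereal (f (xs, ys)) \<and> f (xs, ys) \<le> f (x, ys)}"

definition saddle_points :: "('a \<times> 'b \<Rightarrow> real) \<Rightarrow> ('a \<times> 'b) set" where
  "saddle_points f = {(xs, ys). \<forall>x y. f (xs, y) \<le> f (xs, ys) \<and> f (xs, ys) \<le> f (x, ys)}"

lemma saddle_points_eq_Int: "saddle_points f = minimax_points f \<inter> maximin_points f"
proof -
  have "ereal (f (xs, ys)) \<le> (SUP y'. ereal (f (x, y')))" if "f (xs, ys) \<le> f (x, ys)" for xs ys x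
    by (rule SUP_upper2[of ys]) (use that in auto)
  moreover have "(INF x'. ereal (f (x', y))) \<le> ereal (f (xs, ys))" if "f (xs, y) \<le> f (xs, ys)" for xs ys y
    by (rule INF_lower2[of xs]) (use that in auto)
  ultimately show ?thesis
    unfolding saddle_points_def minimax_points_def maximin_points_def by fast
qed

text \<open>The distance to the empty set is infinite, whereas \<^term>\<open>infdist y {}\<close> is \<open>0\<close>; hence the
  nonemptiness condition on \<open>S x\<close>.\<close>

definition locally_inner_lipschitz_at ::
  "('a::real_normed_vector \<Rightarrow> 'b::real_normed_vector set) \<Rightarrow> 'a \<Rightarrow> 'b \<Rightarrow> bool" where
  "locally_inner_lipschitz_at S xb yb \<longleftrightarrow> yb \<in> S xb \<and>
     (\<exists>\<kappa>\<ge>0. \<exists>N. open N \<and> xb \<in> N \<and>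
        (\<forall>x\<in>N. S x \<noteq> {} \<and> infdist yb (S x) \<le> \<kappa> * norm (x - xb)))"

end

theory Submission
  imports Defs
begin

text \<open>At a minimax point \<open>(a, b)\<close> the partial gradient in \<open>y\<close> vanishes, and inner Lipschitz
  continuity gives best responses \<open>y(x)\<close> with \<open>|y(x) - b| = O(|x - a|)\<close>. So
  \<open>f (a, b) \<le> f (x, y(x))\<close> expands to first order as a condition on the partial gradient in \<open>x\<close>
  alone, which must vanish; invexity upgrades \<open>(a, b)\<close> to a saddle point. Hence all three sets
  agree, so for one saddle point \<open>(a, b)\<close> the set of saddle points is the full product
  \<open>BR_x f b \<times> BR_y f a\<close>. Each factor is the set of minimizers of an invex function that is
  increasing at infinity. Such a set is connected by a mountain pass argument: were it separated, a
  continuous descent map fixing all minimizers, iterated often enough, would deform a segment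
  joining the two parts into a neighbourhood of the set of minimizers.\<close>

section \<open>Descent and connectedness of the minimizers of an invex function\<close>

text \<open>By the mean value theorem the change of \<open>g\<close> is governed by one gradient on
  the segment. That gradient differs from \<open>G y\<close> by at most \<open>e / 2\<close>, so the
  rate of decrease per unit length is at least \<open>norm (G y) - e / 2\<close>, hence at least
  \<open>e / 2\<close>.\<close>

lemma GDERIV_descent:
  fixes g :: "'a::real_inner \<Rightarrow> real"
  assumes deriv: "\<And>x. GDERIV g x :> G x"
    and close: "\<And>z. dist z y \<le> r * norm (G y) \<Longrightarrow> norm (G z - G y) \<le> e / 2"
    and "r \<ge> 0" "norm (G y) \<ge> e"
  shows "g (y - r *\<^sub>R G y) \<le> g y - r * norm (G y) * e / 2"
proof -
  define s where "s = - (r *\<^sub>R G y)"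
  define h where "h = (\<lambda>t::real. g (y + t *\<^sub>R s))"
  have "(h has_derivative (\<lambda>u. (u *\<^sub>R s) \<bullet> G (y + t *\<^sub>R s))) (at t)" for t
  proof -
    have "((\<lambda>t. y + t *\<^sub>R s) has_derivative (\<lambda>u. u *\<^sub>R s)) (at t)"
      by (auto intro!: derivative_eq_intros)
    from has_derivative_compose[OF this deriv[unfolded gderiv_def, of "y + t *\<^sub>R s"]]
    show ?thesis by (simp add: h_def)
  qed
  then obtain t where t: "t \<in> {0<..<1}" and "h 1 - h 0 = (1 - 0) *\<^sub>R s \<bullet> G (y + t *\<^sub>R s)"
    using mvt_simple[of 0 1 h "\<lambda>t u. (u *\<^sub>R s) \<bullet> G (y + t *\<^sub>R s)"]
    by (auto simp: has_derivative_at_withinI)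
  then have h: "g (y + s) - g y = s \<bullet> G (y + t *\<^sub>R s)"
    by (simp add: h_def)
  have ns: "norm s = r * norm (G y)"
    using \<open>r \<ge> 0\<close> by (simp add: s_def)
  have "norm (t *\<^sub>R s) \<le> 1 * norm s"
    using t by (simp add: mult_left_le_one_le)
  then have "norm (G (y + t *\<^sub>R s) - G y) \<le> e / 2"
    using ns by (intro close) (simp add: dist_norm)
  then have "s \<bullet> (G (y + t *\<^sub>R s) - G y) \<le> norm s * (e / 2)"
    by (meson norm_cauchy_schwarz order_trans mult_left_mono norm_ge_zero)
  moreover have "s \<bullet> G y = - (norm s * norm (G y))"
    by (simp add: ns) (simp add: s_def dot_square_norm power2_eq_square)
  moreover have "norm s * norm (G y) \<ge> norm s * e"
    using assms(4) by (simp add: mult_left_mono)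
  ultimately have "g (y + s) - g y \<le> - (norm s * e / 2)"
    by (simp add: h inner_diff_right)
  then show ?thesis
    using ns by (simp add: s_def del: norm_minus_cancel norm_scaleR)
qed

lemma GDERIV_at_min:
  assumes "GDERIV g x :> D" "\<And>z. g x \<le> g z"
  shows "D = 0"
proof -
  have "(\<lambda>h. h \<bullet> D) = (\<lambda>h. 0)"
    using differential_zero_maxmin[of x UNIV g "\<lambda>h. h \<bullet> D"] assms by (auto simp: gderiv_def)
  then have "D \<bullet> D = 0" by metis
  then show ?thesis by simp
qed

lemma connected_argmin_invex:
  fixes g :: "'a::euclidean_space \<Rightarrow> real"
  assumes deriv: "\<And>x. GDERIV g x :> G x" and contG: "continuous_on UNIV G"
    and "invex g" and "increasing_at_infinity g"
  shows "connected {x. \<forall>z. g x \<le> g z}" (is "connected ?M")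
proof (rule ccontr)
  assume not_conn: "\<not> connected ?M"
  have contg: "continuous_on A g" for A
    by (rule has_derivative_continuous_on, rule has_derivative_at_withinI)
      (rule deriv[unfolded gderiv_def])
  have crit: "G x = 0 \<longleftrightarrow> x \<in> ?M" for x
  proof
    assume "G x = 0"
    with deriv[of x] show "x \<in> ?M"
      using \<open>invex g\<close> by (simp add: invex_def)
  next
    assume "x \<in> ?M"
    then show "G x = 0" using GDERIV_at_min[OF deriv] by simp
  qed
  have "?M = (\<Inter>z. {x. g x \<le> g z})" by auto
  moreover have "closed {x. g x \<le> k}" for k
    using contg[of UNIV] by (intro closed_Collect_le) auto
  ultimately have "closed ?M" by auto
  with not_conn obtain A B where AB: "closed A" "closed B" "A \<noteq> {}" "B \<noteq> {}" "A \<union> B = ?M"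
      "A \<inter> B = {}"
    using connected_closed_set[OF \<open>closed ?M\<close>] by metis
  then obtain U V where UV: "open U" "open V" "A \<subseteq> U" "B \<subseteq> V" "U \<inter> V = {}"
    using separation_normal[OF AB(1,2,6)] by metis
  obtain a b where ab: "a \<in> A" "b \<in> B" using AB by auto
  obtain z0 where z0: "\<And>z. z \<in> closed_segment a b \<Longrightarrow> g z \<le> g z0"
    using continuous_attains_sup[OF compact_segment _ contg, of a b] by auto
  \<comment> \<open>A compact set that contains the segment and is preserved by any map that does
    not increase \<open>g\<close>.\<close>
  define L where "L = {z. g z \<le> g z0}"
  obtain K where "compact K" "\<And>z. z \<notin> K \<Longrightarrow> g z > g z0"
    using \<open>increasing_at_infinity g\<close> unfolding increasing_at_infinity_def by blast
  then have "L \<subseteq> K" by (force simp: L_def)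
  have "closed L" unfolding L_def by fact
  with \<open>L \<subseteq> K\<close> \<open>compact K\<close> have "compact L"
    by (metis compact_Int_closed inf.absorb_iff2)
  have seg: "closed_segment a b \<subseteq> L" using z0 by (auto simp: L_def)
  have sep: "\<exists>z\<in>T. z \<notin> U \<union> V" if "connected T" "a \<in> T" "b \<in> T" for T
    using connectedD[OF \<open>connected T\<close> UV(1,2)] that ab UV by auto
  \<comment> \<open>Every connected subset of \<open>L\<close> containing \<open>a\<close> and
    \<open>b\<close> must meet \<open>D\<close>, so it must reach the level \<open>c\<close>, the
    minimum of \<open>g\<close> on \<open>D\<close>.\<close>
  define D where "D = L - (U \<union> V)"
  have "compact D" unfolding D_def using \<open>compact L\<close> UV by (intro compact_diff) auto
  moreover have "D \<noteq> {}"
    using sep[of "closed_segment a b"] seg by (auto simp: D_def)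
  ultimately obtain d where d: "d \<in> D" "\<And>z. z \<in> D \<Longrightarrow> g d \<le> g z"
    using continuous_attains_inf[OF _ _ contg] by metis
  define c where "c = g d"
  have "d \<notin> ?M" using d(1) AB(5) UV by (auto simp: D_def)
  \<comment> \<open>The slab of levels from \<open>c\<close> to \<open>g z0\<close>. As
    \<open>c\<close> exceeds the global minimum, invexity excludes critical points here, and
    compactness bounds \<open>norm (G z)\<close> below by a positive constant, \<open>2 * e\<close>
    in the notation below.\<close>
  define P where "P = L \<inter> {z. c \<le> g z}"
  have "closed {z. c \<le> g z}"
    using contg[of UNIV] by (intro closed_Collect_le) auto
  then have "compact P" unfolding P_def using \<open>compact L\<close> by blast
  moreover have "d \<in> P" using d(1) by (auto simp: P_def D_def c_def)
  ultimately obtain p where p: "p \<in> P" "\<And>z. z \<in> P \<Longrightarrow> norm (G p) \<le> norm (G z)"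
    using continuous_attains_inf[of P "\<lambda>z. norm (G z)"] contG
    by (metis continuous_on_norm continuous_on_subset empty_iff subset_UNIV)
  have "p \<notin> ?M"
    using p(1) \<open>d \<notin> ?M\<close> by (auto simp: P_def c_def) (meson order_trans)
  then have "norm (G p) > 0" using crit by auto
  define e where "e = norm (G p) / 2"
  have "e > 0" using \<open>norm (G p) > 0\<close> by (simp add: e_def)
  \<comment> \<open>Points near \<open>L\<close> may lie outside it; the unit margin keeps both
    arguments of \<open>G\<close> in one compact set as long as \<eta> is at most 1.\<close>
  define L' where "L' = {x + y | x y. x \<in> L \<and> y \<in> cball 0 (1::real)}"
  have "compact L'" unfolding L'_def
    using \<open>compact L\<close> compact_cball by (rule compact_sums)
  then have "uniformly_continuous_on L' G"
    using contG compact_uniformly_continuous continuous_on_subset by blast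
  then obtain \<eta>0 where \<eta>0: "\<eta>0 > 0"
      "\<And>x y. x \<in> L' \<Longrightarrow> y \<in> L' \<Longrightarrow> dist x y < \<eta>0 \<Longrightarrow> dist (G x) (G y) < e / 2"
    unfolding uniformly_continuous_on_def using \<open>e > 0\<close> by (metis half_gt_zero)
  define \<eta> where "\<eta> = min 1 (\<eta>0 / 2)"
  have \<eta>: "\<eta> > 0" "\<eta> \<le> 1" "\<eta> < \<eta>0" using \<eta>0(1) by (auto simp: \<eta>_def)
  have close: "norm (G z - G y) \<le> e / 2" if "y \<in> L" "dist z y \<le> \<eta>" for y z
  proof -
    have "y + w \<in> L'" if "norm w \<le> 1" for w
      unfolding L'_def using \<open>y \<in> L\<close> that by auto
    from this[of 0] this[of "z - y"] have "z \<in> L'" "y \<in> L'"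
      using that \<eta> by (auto simp: dist_norm)
    with \<eta>0(2)[of z y] that \<eta> show ?thesis by (simp add: dist_norm)
  qed
  have "bounded (G ` L)"
    by (intro compact_imp_bounded compact_continuous_image \<open>compact L\<close>
        continuous_on_subset[OF contG] subset_UNIV)
  then obtain R where R: "R > 0" "\<And>y. y \<in> L \<Longrightarrow> norm (G y) \<le> R"
    unfolding bounded_pos by auto
  \<comment> \<open>Scaled so that a step from a point of \<open>L\<close> has length at most
    \<open>\<tau> * R * R\<close>, which is \<eta>.\<close>
  define \<tau> where "\<tau> = \<eta> / R\<^sup>2"
  have "\<tau> > 0" using R \<eta> by (simp add: \<tau>_def)
  \<comment> \<open>The cutoff at \<open>e\<close> keeps the step continuous and never increasing although \<open>G\<close> is only
    continuous: where it acts, \<open>G\<close> varies along the step by at most half its norm.\<close>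
  define r where "r = (\<lambda>y. \<tau> * max 0 (norm (G y) - e))"
  define S where "S = (\<lambda>y. y - r y *\<^sub>R G y)"
  have "r y \<ge> 0" for y using \<open>\<tau> > 0\<close> by (simp add: r_def)
  have step: "g (S y) \<le> g y - r y * norm (G y) * e / 2" if "y \<in> L" for y
  proof (cases "norm (G y) \<ge> e")
    case True
    have "r y * norm (G y) \<le> (\<tau> * R) * R"
      unfolding r_def using True R(2)[OF that] \<open>\<tau> > 0\<close> \<open>e > 0\<close> R(1) by (intro mult_mono) auto
    also have "\<dots> = \<eta>" using R(1) by (simp add: \<tau>_def power2_eq_square)
    finally have "r y * norm (G y) \<le> \<eta>" .
    then show ?thesis unfolding S_def
      using close[OF that] True \<open>r y \<ge> 0\<close> by (intro GDERIV_descent[OF deriv]) auto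
  next
    case False
    then show ?thesis by (simp add: S_def r_def)
  qed
  have S_L: "g (S y) \<le> g y" if "y \<in> L" for y
  proof -
    have "0 \<le> r y * norm (G y) * e / 2" using \<open>r y \<ge> 0\<close> \<open>e > 0\<close> by simp
    with step[OF that] show ?thesis by linarith
  qed
  \<comment> \<open>On \<open>P\<close> the gradient norm is at least \<open>2 * e\<close>, hence
    \<open>r y\<close> is at least \<open>\<tau> * e\<close>; inserting both into
    \<open>step\<close> gives this uniform drop.\<close>
  define \<delta> where "\<delta> = \<tau> * e * (2 * e) * e / 2"
  have "\<delta> > 0" using \<open>\<tau> > 0\<close> \<open>e > 0\<close> by (simp add: \<delta>_def)
  have S_P: "g (S y) \<le> g y - \<delta>" if "y \<in> P" for y
  proof -
    have "2 * e \<le> norm (G y)" using p(2)[OF that] by (simp add: e_def)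
    then have "(\<tau> * e) * (2 * e) \<le> r y * norm (G y)"
      using \<open>\<tau> > 0\<close> \<open>e > 0\<close> unfolding r_def by (intro mult_mono) auto
    then have "\<delta> \<le> r y * norm (G y) * e / 2"
      unfolding \<delta>_def using \<open>e > 0\<close> by (intro divide_right_mono mult_right_mono) auto
    with step[of y] that show ?thesis by (simp add: P_def)
  qed
  have contS: "continuous_on UNIV S"
    unfolding S_def r_def using contG by (intro continuous_intros)
  \<comment> \<open>Once below \<open>c\<close> an iterate stays there; until then it lies in
    \<open>P\<close> and each step lowers \<open>g\<close> by at least \<delta>.\<close>
  have iter: "(S ^^ n) y \<in> L \<and> (g ((S ^^ n) y) < c \<or> g ((S ^^ n) y) \<le> g z0 - n * \<delta>)"
    if "y \<in> L" for n y
  proof (induction n)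
    case 0
    then show ?case using that by (simp add: L_def)
  next
    case (Suc n)
    let ?w = "(S ^^ n) y"
    have "g (S ?w) \<le> g ?w" using S_L Suc by blast
    moreover have "g (S ?w) \<le> g ?w - \<delta>" if "g ?w \<ge> c"
      using S_P Suc that by (simp add: P_def)
    ultimately show ?case using Suc by (force simp: L_def algebra_simps)
  qed
  obtain N :: nat where N: "g z0 - c < N * \<delta>"
    using \<open>\<delta> > 0\<close> reals_Archimedean3 by blast
  let ?T = "(S ^^ N) ` closed_segment a b"
  have contSn: "continuous_on UNIV (S ^^ n)" for n
  proof (induction n)
    case (Suc n)
    then show ?case
      using continuous_on_compose[OF Suc continuous_on_subset[OF contS subset_UNIV]] by simp
  qed (simp add: id_def)
  then have "connected ?T"
    by (intro connected_continuous_image connected_segment continuous_on_subset[OF contSn]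
        subset_UNIV)
  \<comment> \<open>The gradient vanishes at minimizers, so the deformed segment still joins
    \<open>a\<close> to \<open>b\<close>.\<close>
  moreover have "(S ^^ N) x = x" if "x \<in> ?M" for x
  proof -
    have "S x = x" using that crit by (simp add: S_def)
    then show ?thesis by (induction N) auto
  qed
  then have "(S ^^ N) a = a" "(S ^^ N) b = b" using ab AB(5) by auto
  then have "a \<in> ?T" "b \<in> ?T" by (metis ends_in_segment image_eqI)+
  ultimately obtain y where y: "y \<in> closed_segment a b" "(S ^^ N) y \<notin> U \<union> V"
    using sep[of ?T] by auto
  have "(S ^^ N) y \<in> L" "g ((S ^^ N) y) < c"
    using iter[of y N] seg y(1) N by (force, fastforce)
  with y(2) d(2)[of "(S ^^ N) y"] show False by (auto simp: D_def c_def)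
qed

section \<open>First-order conditions from inner Lipschitz best responses\<close>

text \<open>The infimum in \<open>infdist\<close> need not be attained, so the constant grows to
  \<open>\<kappa> + 1\<close>: the slack is positive for \<open>x \<noteq> a\<close>, and at
  \<open>a\<close> the point \<open>b\<close> itself serves.\<close>

lemma locally_inner_lipschitz_at_selection:
  assumes "locally_inner_lipschitz_at S a b"
  obtains \<kappa> N where "\<kappa> \<ge> 0" "open N" "a \<in> N"
    "\<And>x. x \<in> N \<Longrightarrow> \<exists>y\<in>S x. norm (y - b) \<le> \<kappa> * norm (x - a)"
proof -
  obtain \<kappa> N where *: "b \<in> S a" "\<kappa> \<ge> 0" "open N" "a \<in> N"
    "\<And>x. x \<in> N \<Longrightarrow> S x \<noteq> {} \<and> infdist b (S x) \<le> \<kappa> * norm (x - a)"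
    using assms unfolding locally_inner_lipschitz_at_def by blast
  have "\<exists>y\<in>S x. norm (y - b) \<le> (\<kappa> + 1) * norm (x - a)" if "x \<in> N" for x
  proof (cases "x = a")
    case True
    then show ?thesis using *(1) by force
  next
    case False
    then have "infdist b (S x) < (\<kappa> + 1) * norm (x - a)"
      using *(5)[OF that] by (simp add: distrib_right le_less_trans[OF _ less_add_same_cancel1[THEN iffD2]])
    moreover have "S x \<noteq> {}" using *(5) that by blast
    ultimately obtain y where "y \<in> S x" "dist b y < (\<kappa> + 1) * norm (x - a)"
      by (auto simp: infdist_def dest!: cInf_lessD[rotated])
    then show ?thesis by (intro bexI[of _ y]) (auto simp: dist_norm norm_minus_commute)
  qed
  with * show ?thesis by (intro that[of "\<kappa> + 1" N]) auto
qed

lemma GDERIV_fst_eq_0: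
  fixes f :: "'a::real_inner \<times> 'b::real_inner \<Rightarrow> real"
  assumes deriv: "GDERIV f (a, b) :> (p, 0)"
    and lip: "locally_inner_lipschitz_at S a b"
    and above: "\<And>x y. y \<in> S x \<Longrightarrow> f (a, b) \<le> f (x, y)"
  shows "p = 0"
proof (rule ccontr)
  assume "p \<noteq> 0"
  obtain \<kappa> N where N: "\<kappa> \<ge> 0" "open N" "a \<in> N"
    "\<And>x. x \<in> N \<Longrightarrow> \<exists>y\<in>S x. norm (y - b) \<le> \<kappa> * norm (x - a)"
    using locally_inner_lipschitz_at_selection[OF lip] by blast
  \<comment> \<open>For a move of \<open>x\<close> by \<open>m\<close> against \<open>p\<close>, the
    pair moves by at most \<open>m * (1 + \<kappa>)\<close>. This \<open>e\<close> limits the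
    remainder to half of the linear decrease \<open>m * norm p\<close>; the move in \<open>y\<close>
    has no first-order effect.\<close>
  define e where "e = norm p / (2 * (1 + \<kappa>))"
  have "e > 0" using \<open>p \<noteq> 0\<close> N(1) by (simp add: e_def)
  then obtain \<delta> where \<delta>: "\<delta> > 0" "\<And>z. norm (z - (a, b)) < \<delta> \<Longrightarrow>
      norm (f z - f (a, b) - (z - (a, b)) \<bullet> (p, 0)) \<le> e * norm (z - (a, b))"
    using deriv unfolding gderiv_def has_derivative_at_alt by blast
  obtain \<rho> where \<rho>: "\<rho> > 0" "ball a \<rho> \<subseteq> N"
    using N(2,3) openE by blast
  define m where "m = min (\<rho> / 2) (\<delta> / (2 * (1 + \<kappa>)))"
  have "m > 0" "m < \<rho>" using \<rho>(1) \<delta>(1) N(1) by (auto simp: m_def)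
  have "m * (1 + \<kappa>) \<le> \<delta> / (2 * (1 + \<kappa>)) * (1 + \<kappa>)"
    using N(1) by (intro mult_right_mono) (auto simp: m_def)
  also have "\<dots> = \<delta> / 2" using N(1) by (simp add: field_simps)
  finally have m\<delta>: "m * (1 + \<kappa>) < \<delta>" using \<delta>(1) by simp
  define x where "x = a - (m / norm p) *\<^sub>R p"
  have nx: "norm (x - a) = m"
    using \<open>m > 0\<close> \<open>p \<noteq> 0\<close> by (simp add: x_def)
  then have "x \<in> N" using \<rho>(2) \<open>m < \<rho>\<close> by (auto simp: dist_norm norm_minus_commute)
  then obtain y where y: "y \<in> S x" "norm (y - b) \<le> \<kappa> * m"
    using N(4) nx by blast
  have "norm ((x, y) - (a, b)) \<le> norm (x - a) + norm (y - b)"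
    by (simp add: norm_Pair sqrt_sum_squares_le_sum)
  then have nz: "norm ((x, y) - (a, b)) \<le> m * (1 + \<kappa>)"
    using y nx by (simp add: algebra_simps)
  have "f (x, y) - f (a, b) - (x - a) \<bullet> p \<le> e * norm ((x, y) - (a, b))"
    using \<delta>(2)[of "(x, y)"] nz m\<delta> by (simp add: inner_Pair)
  also have "\<dots> \<le> e * (m * (1 + \<kappa>))"
    using nz \<open>e > 0\<close> by (intro mult_left_mono) auto
  also have "\<dots> = m * norm p / 2"
    using N(1) by (simp add: e_def field_simps)
  finally have "f (x, y) - f (a, b) \<le> m * norm p / 2 + (x - a) \<bullet> p" by simp
  also have "(x - a) \<bullet> p = - (m * norm p)"
    using \<open>p \<noteq> 0\<close> by (simp add: x_def dot_square_norm power2_eq_square)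
  finally have "f (x, y) < f (a, b)"
    using \<open>m > 0\<close> \<open>p \<noteq> 0\<close> by (smt (verit) mult_pos_pos field_sum_of_halves zero_less_norm_iff)
  with above[OF y(1)] show False by simp
qed

lemma GDERIV_partial:
  fixes f :: "'a::real_inner \<times> 'b::real_inner \<Rightarrow> real"
  assumes "GDERIV f (x, y) :> D"
  shows "GDERIV (\<lambda>x. f (x, y)) x :> fst D" "GDERIV (\<lambda>y. f (x, y)) y :> snd D"
proof -
  have "((\<lambda>x. (x, y)) has_derivative (\<lambda>h. (h, 0))) (at x)"
    "((\<lambda>y. (x, y)) has_derivative (\<lambda>h. (0, h))) (at y)"
    by (auto intro!: derivative_eq_intros)
  from this[THEN has_derivative_compose, OF assms[unfolded gderiv_def]]
  show "GDERIV (\<lambda>x. f (x, y)) x :> fst D" "GDERIV (\<lambda>y. f (x, y)) y :> snd D"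
    by (simp_all add: gderiv_def inner_prod_def)
qed

text \<open>\<open>S\<close> is kept abstract so that the result serves both best response maps, the
  second one after negating \<open>f\<close> and exchanging its variables.\<close>

lemma minimax_point_imp_min:
  fixes f :: "'a::real_inner \<times> 'b::real_inner \<Rightarrow> real"
  assumes deriv: "GDERIV f (a, b) :> D" and "invex (\<lambda>x. f (x, b))"
    and lip: "locally_inner_lipschitz_at S a b"
    and max: "\<And>y. f (a, y) \<le> f (a, b)"
    and above: "\<And>x y. y \<in> S x \<Longrightarrow> f (a, b) \<le> f (x, y)"
  shows "f (a, b) \<le> f (x, b)"
proof -
  have "GDERIV (\<lambda>y. - f (a, y)) b :> - snd D"
    using GDERIV_partial(2)[OF deriv] by (rule GDERIV_minus)
  then have "snd D = 0" using GDERIV_at_min[of _ b "- snd D"] max by force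
  then have "D = (fst D, 0)" by (simp add: prod_eq_iff)
  then have "fst D = 0" using GDERIV_fst_eq_0[of f a b "fst D" S] deriv lip above by simp
  then have "GDERIV (\<lambda>x. f (x, b)) a :> 0" using GDERIV_partial(1)[OF deriv] by simp
  then show ?thesis using \<open>invex _\<close> by (simp add: invex_def)
qed

lemma GDERIV_swap_uminus:
  fixes f :: "'a::real_inner \<times> 'b::real_inner \<Rightarrow> real"
  assumes "GDERIV f (x, y) :> D"
  shows "GDERIV (\<lambda>(y, x). - f (x, y)) (y, x) :> - prod.swap D"
proof -
  have "(prod.swap has_derivative prod.swap) (at (y, x))"
    unfolding prod.swap_def by (auto intro!: derivative_eq_intros)
  moreover have "(f has_derivative (\<lambda>h. h \<bullet> D)) (at (prod.swap (y, x)))"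
    using assms by (simp add: gderiv_def)
  ultimately have "((\<lambda>z. - f (prod.swap z)) has_derivative (\<lambda>h. - (prod.swap h \<bullet> D))) (at (y, x))"
    by (rule has_derivative_minus[OF has_derivative_compose])
  moreover have "(\<lambda>(y, x). - f (x, y)) = (\<lambda>z. - f (prod.swap z))"
    "(\<lambda>h. - (prod.swap h \<bullet> D)) = (\<lambda>h. h \<bullet> - prod.swap D)"
    by (auto simp: inner_prod_def fun_eq_iff)
  ultimately show ?thesis by (simp add: gderiv_def)
qed

theorem theorem3:
  fixes f :: "(real ^ 'nx) \<times> (real ^ 'ny) \<Rightarrow> real"
  assumes "continuously_differentiable f"
    and "\<And>x. incave (\<lambda>y. f (x, y))"
    and "\<And>x. decreasing_at_infinity (\<lambda>y. f (x, y))"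
    and "\<And>y. invex (\<lambda>x. f (x, y))"
    and "\<And>y. increasing_at_infinity (\<lambda>x. f (x, y))"
    and "\<And>x y. (x, y) \<in> minimax_points f \<Longrightarrow> locally_inner_lipschitz_at (BR_y f) x y"
    and "\<And>x y. (x, y) \<in> maximin_points f \<Longrightarrow> locally_inner_lipschitz_at (BR_x f) y x"
  shows "saddle_points f = minimax_points f \<and> minimax_points f = maximin_points f \<and>
    connected (saddle_points f)"
proof -
  obtain G where deriv: "\<And>z. GDERIV f z :> G z" and contG: "continuous_on UNIV G"
    using assms(1) unfolding continuously_differentiable_def by blast
  have BRy: "y \<in> BR_y f x \<longleftrightarrow> (\<forall>y'. f (x, y') \<le> f (x, y))" for x y
    by (auto simp: BR_y_def is_arg_max_def not_less)
  have BRx: "x \<in> BR_x f y \<longleftrightarrow> (\<forall>x'. f (x, y) \<le> f (x', y))" for x y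
    by (auto simp: BR_x_def is_arg_min_def not_less)

  \<comment> \<open>Coincidence of the three sets\<close>
  have minimax: "(a, b) \<in> saddle_points f" if ab: "(a, b) \<in> minimax_points f" for a b
  proof -
    have max: "\<And>y. f (a, y) \<le> f (a, b)"
      and sup: "\<And>x. ereal (f (a, b)) \<le> (SUP y'. ereal (f (x, y')))"
      using ab by (auto simp: minimax_points_def)
    have "f (a, b) \<le> f (x, y)" if "y \<in> BR_y f x" for x y
    proof -
      note sup[of x]
      also have "(SUP y'. ereal (f (x, y'))) \<le> ereal (f (x, y))"
        using that by (intro SUP_least) (auto simp: BRy)
      finally show ?thesis by simp
    qed
    then have "f (a, b) \<le> f (x, b)" for x
      using minimax_point_imp_min[OF deriv assms(4) assms(6)[OF ab] max] by blast
    with max show ?thesis by (auto simp: saddle_points_def)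
  qed
  have maximin: "(a, b) \<in> saddle_points f" if ab: "(a, b) \<in> maximin_points f" for a b
  proof -
    have min: "\<And>x. f (a, b) \<le> f (x, b)"
      and inf: "\<And>y. (INF x'. ereal (f (x', y))) \<le> ereal (f (a, b))"
      using ab by (auto simp: maximin_points_def)
    have "f (x, y) \<le> f (a, b)" if "x \<in> BR_x f y" for x y
    proof -
      have "ereal (f (x, y)) \<le> (INF x'. ereal (f (x', y)))"
        using that by (intro INF_greatest) (auto simp: BRx)
      also note inf[of y]
      finally show ?thesis by simp
    qed
    \<comment> \<open>For the negated function with exchanged variables, \<open>(b, a)\<close> is in
      the minimax situation, and incavity in \<open>y\<close> becomes invexity in the first
      variable.\<close>
    then have "(\<lambda>(y, x). - f (x, y)) (b, a) \<le> (\<lambda>(y, x). - f (x, y)) (y, a)" for y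
      by (intro minimax_point_imp_min[OF GDERIV_swap_uminus[OF deriv] _ assms(7)[OF ab]])
        (use assms(2)[of a] min in \<open>simp_all add: incave_def\<close>)
    then have "f (a, y) \<le> f (a, b)" for y by simp
    with min show ?thesis by (auto simp: saddle_points_def)
  qed
  have E1: "saddle_points f = minimax_points f"
    using minimax saddle_points_eq_Int[of f] by auto
  moreover have E2: "saddle_points f = maximin_points f"
    using maximin saddle_points_eq_Int[of f] by auto

  \<comment> \<open>Product structure and connectedness of the saddle points\<close>
  moreover have "connected (saddle_points f)"
  proof (cases "saddle_points f = {}")
    case False
    then obtain a b where ab: "(a, b) \<in> saddle_points f" by auto
    have "saddle_points f = BR_x f b \<times> BR_y f a"
    proof (intro set_eqI iffI; clarify)
      fix x y assume "(x, y) \<in> saddle_points f"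
      then show "x \<in> BR_x f b \<and> y \<in> BR_y f a"
        using ab by (auto simp: BRx BRy saddle_points_def) (meson order_trans)+
    next
      fix x y assume x: "x \<in> BR_x f b" and y: "y \<in> BR_y f a"
      \<comment> \<open>Replacing one coordinate by another best response keeps the value, so
        \<open>(x, b)\<close> inherits the maximin and \<open>(a, y)\<close> the minimax property.
        The equality of the sets makes both saddle points, and chaining their inequalities through
        \<open>f (a, b)\<close> handles \<open>(x, y)\<close>.\<close>
      have "f (x, b) = f (a, b)" "f (a, y) = f (a, b)"
        using ab x y by (auto simp: BRx BRy saddle_points_def intro: antisym)
      moreover have "(a, b) \<in> maximin_points f" "(a, b) \<in> minimax_points f"
        using ab E1 E2 by auto
      ultimately have "(x, b) \<in> maximin_points f" "(a, y) \<in> minimax_points f"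
        using x y by (simp_all add: maximin_points_def minimax_points_def BRx BRy)
      then have "(x, b) \<in> saddle_points f" "(a, y) \<in> saddle_points f"
        using E1 E2 by auto
      then show "(x, y) \<in> saddle_points f"
        by (auto simp: saddle_points_def) (meson order_trans)+
    qed
    moreover have "connected (BR_x f b)"
    proof -
      have "continuous_on UNIV (\<lambda>x. fst (G (x, b)))"
        by (intro continuous_intros continuous_on_compose2[OF contG]) auto
      from connected_argmin_invex[OF GDERIV_partial(1)[OF deriv] this assms(4,5)]
      show ?thesis by (simp add: BRx[THEN Collect_cong, symmetric])
    qed
    moreover have "connected (BR_y f a)"
    proof -
      have "continuous_on UNIV (\<lambda>y. - snd (G (a, y)))"
        by (intro continuous_intros continuous_on_compose2[OF contG]) auto
      from connected_argmin_invex[OF GDERIV_minus[OF GDERIV_partial(2)[OF deriv]] this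
          assms(2,3)[unfolded incave_def decreasing_at_infinity_def]]
      show ?thesis by (simp add: BRy[THEN Collect_cong, symmetric])
    qed
    ultimately show ?thesis by (simp add: connected_Times)
  qed simp
  ultimately show ?thesis by simp
qed

end
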